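(* Let $G$ be a finite group. A linear map $L^*:\mathbb C(G)\to\mathbb C(G)$ is a $\mathbb C(G)$-bicomodule map with respect to the left and right coregular coactions if and only if the eigenspaces of $L^*$ are direct sums of spaces of the form $\mathrm{span}_{\mathbb C}\{\rho^i{}_j\}$ for irreducible representations $\rho$ of $G$, where $\rho^i{}_j\in\mathbb C(G)$ is the function $\rho^i{}_j(g)=\rho(g)^i{}_j$.
   Context: $\mathbb C(G)$ is the Hopf algebra of complex functions on $G$ with basis $\delta_g$, pointwise product and coproduct $\Delta\delta_g=\sum_{ab=g}\delta_a\otimes\delta_b$. The left and right coregular coactions of $\mathbb C(G)$ on itself are both given by $\Delta$; equivalently, a bicomodule map is one commuting with left and right translations by $G$. For each irreducible representation $\rho$, $\mathrm{span}_{\mathbb C}\{\rho^i{}_j\}$ is the span over all matrix indices $i,j$.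
   Formalization: The right-hand side also requires that C(G) be the direct sum of the eigenspaces of L* (L* diagonalisable); without this the "if" direction fails, e.g. G=Z_2, L*(1)=0, L*(sgn)=1. Every bicomodule map satisfies it. *)

theory Defs
  imports
    "HOL-Library.Function_Algebras"
    "HOL-Algebra.Group"
    "Jordan_Normal_Form.VS_Connect"
begin

section \<open>The vector space of complex functions\<close>

definition fscale :: "complex \<Rightarrow> ('x \<Rightarrow> complex) \<Rightarrow> 'x \<Rightarrow> complex" where
  "fscale c f = (\<lambda>x. c * f x)"

interpretation fn: vector_space "fscale :: complex \<Rightarrow> ('x \<Rightarrow> complex) \<Rightarrow> 'x \<Rightarrow> complex"
  by unfold_locales (auto simp: fscale_def fun_eq_iff algebra_simps)

text \<open>A function on a set \<open>X\<close> is represented by its extension by zero, so that the functions on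
  \<open>X\<close> form a subspace of the pointwise vector space on the whole type.\<close>

definition functions_on :: "'x set \<Rightarrow> ('x \<Rightarrow> complex) set" where
  "functions_on X = {f. \<forall>x. x \<notin> X \<longrightarrow> f x = 0}"

lemma subspace_functions_on: "fn.subspace (functions_on X)"
  by (auto simp: fn.subspace_def functions_on_def fscale_def)

definition linear_endo :: "('x \<Rightarrow> complex) set \<Rightarrow> (('x \<Rightarrow> complex) \<Rightarrow> 'x \<Rightarrow> complex) \<Rightarrow> bool" where
  "linear_endo V L \<longleftrightarrow>
     (\<forall>f\<in>V. L f \<in> V) \<and>
     (\<forall>f\<in>V. \<forall>h\<in>V. L (f + h) = L f + L h) \<and>
     (\<forall>c. \<forall>f\<in>V. L (fscale c f) = fscale c (L f))"

definition internal_direct_sum ::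
  "('x \<Rightarrow> complex) set \<Rightarrow> 'i set \<Rightarrow> ('i \<Rightarrow> ('x \<Rightarrow> complex) set) \<Rightarrow> bool" where
  "internal_direct_sum V I W \<longleftrightarrow>
     finite I \<and> (\<forall>i\<in>I. fn.subspace (W i)) \<and>
     V = {\<Sum>i\<in>I. w i | w. \<forall>i\<in>I. w i \<in> W i} \<and>
     (\<forall>w. (\<forall>i\<in>I. w i \<in> W i) \<and> (\<Sum>i\<in>I. w i) = 0 \<longrightarrow> (\<forall>i\<in>I. w i = 0))"

definition eigenspace ::
  "('x \<Rightarrow> complex) set \<Rightarrow> (('x \<Rightarrow> complex) \<Rightarrow> 'x \<Rightarrow> complex) \<Rightarrow> complex \<Rightarrow> ('x \<Rightarrow> complex) set" where
  "eigenspace V L c = {f \<in> V. L f = fscale c f}"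

definition eigenvalues ::
  "('x \<Rightarrow> complex) set \<Rightarrow> (('x \<Rightarrow> complex) \<Rightarrow> 'x \<Rightarrow> complex) \<Rightarrow> complex set" where
  "eigenvalues V L = {c. \<exists>f \<in> eigenspace V L c. f \<noteq> 0}"

section \<open>The coalgebra of functions on a finite group and its bicomodule maps\<close>

abbreviation group_functions :: "('g, 'm) monoid_scheme \<Rightarrow> ('g \<Rightarrow> complex) set" where
  "group_functions G \<equiv> functions_on (carrier G)"

definition delta :: "'g \<Rightarrow> 'g \<Rightarrow> complex" where
  "delta g = (\<lambda>x. if x = g then 1 else 0)"

text \<open>The tensor square of the function space of \<open>G\<close> is identified with the functions on
  \<open>carrier G \<times> carrier G\<close>; its basis consists of the elementary tensors of basis functions.\<close>

definition tensor :: "('g \<Rightarrow> complex) \<Rightarrow> ('g \<Rightarrow> complex) \<Rightarrow> 'g \<times> 'g \<Rightarrow> complex" where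
  "tensor f h = (\<lambda>(a, b). f a * h b)"

definition tensor_map ::
  "('g, 'm) monoid_scheme \<Rightarrow> (('g \<Rightarrow> complex) \<Rightarrow> 'g \<Rightarrow> complex) \<Rightarrow>
   (('g \<Rightarrow> complex) \<Rightarrow> 'g \<Rightarrow> complex) \<Rightarrow> ('g \<times> 'g \<Rightarrow> complex) \<Rightarrow> 'g \<times> 'g \<Rightarrow> complex" where
  "tensor_map G S T F =
     (\<Sum>(a, b)\<in>carrier G \<times> carrier G. fscale (F (a, b)) (tensor (S (delta a)) (T (delta b))))"

definition coproduct :: "('g, 'm) monoid_scheme \<Rightarrow> ('g \<Rightarrow> complex) \<Rightarrow> 'g \<times> 'g \<Rightarrow> complex" where
  "coproduct G f =
     (\<Sum>g\<in>carrier G. fscale (f g)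
        (\<Sum>(a, b)\<in>{(a, b). a \<in> carrier G \<and> b \<in> carrier G \<and> a \<otimes>\<^bsub>G\<^esub> b = g}.
           tensor (delta a) (delta b)))"

abbreviation left_coregular :: "('g, 'm) monoid_scheme \<Rightarrow> ('g \<Rightarrow> complex) \<Rightarrow> 'g \<times> 'g \<Rightarrow> complex" where
  "left_coregular G \<equiv> coproduct G"

abbreviation right_coregular :: "('g, 'm) monoid_scheme \<Rightarrow> ('g \<Rightarrow> complex) \<Rightarrow> 'g \<times> 'g \<Rightarrow> complex" where
  "right_coregular G \<equiv> coproduct G"

text \<open>Here \<open>\<alpha>\<close> is a left and \<open>\<beta>\<close> a right coaction of the function coalgebra on itself: the
  coacting tensor factor is the first one for \<open>\<alpha>\<close> and the second one for \<open>\<beta>\<close>.\<close>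

definition bicomodule_map ::
  "('g, 'm) monoid_scheme \<Rightarrow> (('g \<Rightarrow> complex) \<Rightarrow> 'g \<times> 'g \<Rightarrow> complex) \<Rightarrow>
   (('g \<Rightarrow> complex) \<Rightarrow> 'g \<times> 'g \<Rightarrow> complex) \<Rightarrow> (('g \<Rightarrow> complex) \<Rightarrow> 'g \<Rightarrow> complex) \<Rightarrow> bool" where
  "bicomodule_map G \<alpha> \<beta> L \<longleftrightarrow>
     linear_endo (group_functions G) L \<and>
     (\<forall>f\<in>group_functions G. \<alpha> (L f) = tensor_map G id L (\<alpha> f)) \<and>
     (\<forall>f\<in>group_functions G. \<beta> (L f) = tensor_map G L id (\<beta> f))"

section \<open>Irreducible representations and their matrix coefficients\<close>

definition matrix_rep :: "('g, 'm) monoid_scheme \<Rightarrow> nat \<Rightarrow> ('g \<Rightarrow> complex mat) \<Rightarrow> bool" where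
  "matrix_rep G n \<rho> \<longleftrightarrow> \<rho> \<in> hom G (units_of (ring_mat TYPE(complex) n ()))"

definition irreducible_rep :: "('g, 'm) monoid_scheme \<Rightarrow> nat \<Rightarrow> ('g \<Rightarrow> complex mat) \<Rightarrow> bool" where
  "irreducible_rep G n \<rho> \<longleftrightarrow>
     matrix_rep G n \<rho> \<and> n > 0 \<and>
     (\<forall>W. VectorSpace.subspace class_ring W (module_vec TYPE(complex) n) \<and>
          (\<forall>g\<in>carrier G. \<forall>v\<in>W. \<rho> g *\<^sub>v v \<in> W) \<longrightarrow>
          W = {0\<^sub>v n} \<or> W = carrier_vec n)"

definition matrix_coeff ::
  "('g, 'm) monoid_scheme \<Rightarrow> ('g \<Rightarrow> complex mat) \<Rightarrow> nat \<Rightarrow> nat \<Rightarrow> 'g \<Rightarrow> complex" where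
  "matrix_coeff G \<rho> i j = (\<lambda>g. if g \<in> carrier G then \<rho> g $$ (i, j) else 0)"

definition coeff_space ::
  "('g, 'm) monoid_scheme \<Rightarrow> nat \<Rightarrow> ('g \<Rightarrow> complex mat) \<Rightarrow> ('g \<Rightarrow> complex) set" where
  "coeff_space G n \<rho> = fn.span {matrix_coeff G \<rho> i j | i j. i < n \<and> j < n}"

section \<open>The structure maps in coordinates\<close>

lemma sum_fun_apply: "(\<Sum>i\<in>I. F i) x = (\<Sum>i\<in>I. F i x)"
  for F :: "'i \<Rightarrow> 'x \<Rightarrow> 'b::comm_monoid_add"
  by (induction I rule: infinite_finite_induct) auto

lemma tensor_delta: "tensor (delta a) (delta b) = delta (a, b)"
  by (auto simp: tensor_def delta_def fun_eq_iff)

lemma coproduct_apply: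
  assumes "group G" and fin: "finite (carrier G)"
  shows "coproduct G f (a, b) =
    (if a \<in> carrier G \<and> b \<in> carrier G then f (a \<otimes>\<^bsub>G\<^esub> b) else 0)"
proof -
  interpret group G by fact
  let ?S = "\<lambda>g. {(a, b). a \<in> carrier G \<and> b \<in> carrier G \<and> a \<otimes>\<^bsub>G\<^esub> b = g}"
  have finS: "finite (?S g)" for g
    by (rule finite_subset[OF _ finite_cartesian_product[OF fin fin]]) auto
  have "(\<Sum>(x, y)\<in>?S g. tensor (delta x) (delta y)) (a, b)
      = (if (a, b) \<in> ?S g then 1 else 0)" for g
  proof -
    have "(\<Sum>(x, y)\<in>?S g. tensor (delta x) (delta y)) (a, b)
        = (\<Sum>p\<in>?S g. if p = (a, b) then 1 else 0)"
      unfolding sum_fun_apply by (rule sum.cong) (auto simp: tensor_def delta_def split: if_splits)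
    also have "\<dots> = (if (a, b) \<in> ?S g then 1 else 0)"
      using finS[of g] by (simp add: sum.delta)
    finally show ?thesis .
  qed
  then have "coproduct G f (a, b)
      = (\<Sum>g\<in>carrier G. f g * (if (a, b) \<in> ?S g then 1 else 0))"
    unfolding coproduct_def sum_fun_apply fscale_def by simp
  also have "\<dots> = (\<Sum>g\<in>carrier G. if g = a \<otimes>\<^bsub>G\<^esub> b then
      (if a \<in> carrier G \<and> b \<in> carrier G then f g else 0) else 0)"
    by (rule sum.cong) auto
  also have "\<dots> = (if a \<in> carrier G \<and> b \<in> carrier G then f (a \<otimes>\<^bsub>G\<^esub> b) else 0)"
    using fin by (simp add: sum.delta)
  finally show ?thesis .
qed

lemma functions_on_expand:
  assumes "finite X" "f \<in> functions_on X"
  shows "f = (\<Sum>x\<in>X. fscale (f x) (delta x))"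
proof
  fix y
  have "(\<Sum>x\<in>X. fscale (f x) (delta x)) y = (\<Sum>x\<in>X. if x = y then f x else 0)"
    unfolding sum_fun_apply by (rule sum.cong) (auto simp: fscale_def delta_def)
  then show "f y = (\<Sum>x\<in>X. fscale (f x) (delta x)) y"
    using assms by (auto simp: functions_on_def)
qed

lemma linear_endo_expand:
  assumes "finite X" and L: "linear_endo (functions_on X) L" and f: "f \<in> functions_on X"
  shows "L f = (\<Sum>x\<in>X. fscale (f x) (L (delta x)))"
proof -
  have z: "L 0 = 0"
  proof -
    have "0 \<in> functions_on X" by (simp add: functions_on_def)
    then have "L (fscale 0 0) = fscale 0 (L 0)" using L unfolding linear_endo_def by blast
    then show ?thesis by simp
  qed
  have d: "fscale c (delta x) \<in> functions_on X" if "x \<in> X" for c x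
    using that by (auto simp: functions_on_def fscale_def delta_def)
  have d1: "delta x \<in> functions_on X" if "x \<in> X" for x
    using that by (auto simp: functions_on_def delta_def)
  have "L (\<Sum>x\<in>Y. fscale (f x) (delta x)) = (\<Sum>x\<in>Y. fscale (f x) (L (delta x)))"
    if "finite Y" "Y \<subseteq> X" for Y
    using that
  proof (induction Y)
    case empty
    then show ?case using z by (simp add: zero_fun_def)
  next
    case (insert y Y)
    then have "(\<Sum>x\<in>Y. fscale (f x) (delta x)) \<in> functions_on X"
      by (intro fn.subspace_sum subspace_functions_on d) auto
    then have "L (fscale (f y) (delta y) + (\<Sum>x\<in>Y. fscale (f x) (delta x)))
        = fscale (f y) (L (delta y)) + L (\<Sum>x\<in>Y. fscale (f x) (delta x))"
      using insert.prems L d[of y] d1[of y] unfolding linear_endo_def by (metis insert_subset)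
    then show ?case
      using insert.IH insert.prems by (simp only: sum.insert[OF insert.hyps] insert_subset)
  qed
  from trans[OF arg_cong[where f = L, OF functions_on_expand[OF assms(1) f]] this[OF assms(1) subset_refl]]
  show ?thesis .
qed

lemma tensor_map_tensor:
  assumes fin: "finite (carrier G)"
    and S: "linear_endo (group_functions G) S" and T: "linear_endo (group_functions G) T"
    and f: "f \<in> group_functions G" and h: "h \<in> group_functions G"
  shows "tensor_map G S T (tensor f h) = tensor (S f) (T h)"
proof
  fix p :: "'a \<times> 'a"
  obtain x y where p: "p = (x, y)" by (cases p)
  have "tensor_map G S T (tensor f h) p
      = (\<Sum>(a, b)\<in>carrier G \<times> carrier G. (f a * S (delta a) x) * (h b * T (delta b) y))"
    unfolding tensor_map_def sum_fun_apply p
    by (rule sum.cong) (auto simp: fscale_def tensor_def)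
  also have "\<dots> = (\<Sum>a\<in>carrier G. f a * S (delta a) x) * (\<Sum>b\<in>carrier G. h b * T (delta b) y)"
    by (simp add: sum_product sum.cartesian_product)
  also have "\<dots> = tensor (S f) (T h) p"
    unfolding p tensor_def using linear_endo_expand[OF fin S f] linear_endo_expand[OF fin T h]
    by (simp add: sum_fun_apply fscale_def)
  finally show "tensor_map G S T (tensor f h) p = tensor (S f) (T h) p" .
qed

end

(* A linear map is a bicomodule map iff it commutes with all left and right translations. These are
   unitary for the pairing of functions on G, so every biinvariant subspace is an orthogonal direct
   sum of minimal ones. A commuting map is a combination of left translations, hence preserves each
   minimal M, and any of its eigenspaces on M is biinvariant, so it is a scalar on M. Finally M is a
   coefficient space: take a minimal right-invariant V in M with orthonormal basis e. The matrix rho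
   of right translation on V is irreducible, rho(g)_ij = <R_g e_j, e_i> is a combination of left
   translates of e_j and so lies in M, and evaluating R_g e_j at 1 writes e_j in terms of the rho_ij.
   Conversely, coefficient spaces are biinvariant, because rho is multiplicative. *)

theory Submission
  imports Defs "Jordan_Normal_Form.Char_Poly"
begin

section \<open>Inner product and orthonormal bases\<close>

definition ip :: "'x set \<Rightarrow> ('x \<Rightarrow> complex) \<Rightarrow> ('x \<Rightarrow> complex) \<Rightarrow> complex" where
  "ip X f h = (\<Sum>x\<in>X. f x * cnj (h x))"

lemma ip_add_left: "ip X (f + f') h = ip X f h + ip X f' h"
  by (simp add: ip_def distrib_right sum.distrib)

lemma ip_diff_left: "ip X (f - f') h = ip X f h - ip X f' h"
  by (simp add: ip_def left_diff_distrib sum_subtractf)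

lemma ip_scale_left: "ip X (fscale c f) h = c * ip X f h"
  by (simp add: ip_def fscale_def sum_distrib_left mult.assoc)

lemma ip_scale_right: "ip X f (fscale c h) = cnj c * ip X f h"
  by (simp add: ip_def fscale_def sum_distrib_left mult.left_commute)

lemma ip_zero_left [simp]: "ip X 0 h = 0"
  by (simp add: ip_def)

lemma ip_sum_left: "ip X (\<Sum>i\<in>I. f i) h = (\<Sum>i\<in>I. ip X (f i) h)"
  by (simp add: ip_def sum_fun_apply sum_distrib_right sum.swap[of _ I])

lemma ip_commute: "ip X h f = cnj (ip X f h)"
  by (simp add: ip_def mult.commute)

lemma ip_self: "ip X f f = complex_of_real (\<Sum>x\<in>X. (cmod (f x))\<^sup>2)"
  unfolding ip_def of_real_sum complex_norm_square ..

lemma ip_self_eq_0: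
  assumes "finite X" "f \<in> functions_on X" "ip X f f = 0"
  shows "f = 0"
proof
  fix x
  have "(\<Sum>x\<in>X. (cmod (f x))\<^sup>2) = 0"
    using assms(3) unfolding ip_self of_real_eq_0_iff .
  then have "\<forall>x\<in>X. (cmod (f x))\<^sup>2 = 0"
    using assms(1) by (subst (asm) sum_nonneg_eq_0_iff) auto
  then show "f x = 0 x"
    using assms(2) by (cases "x \<in> X") (auto simp: functions_on_def)
qed

lemma normalize_function:
  assumes "finite X" "f \<in> functions_on X" "f \<noteq> 0"
  obtains c where "ip X (fscale c f) (fscale c f) = 1"
proof -
  let ?r = "\<Sum>x\<in>X. (cmod (f x))\<^sup>2"
  have "?r \<noteq> 0"
    using ip_self_eq_0[OF assms(1,2)] assms(3) unfolding ip_self by (metis of_real_0)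
  then have "?r > 0"
    by (metis less_eq_real_def sum_nonneg zero_le_power2)
  define c where "c = complex_of_real (1 / sqrt ?r)"
  have "ip X (fscale c f) (fscale c f) = c * (cnj c * ip X f f)"
    by (simp add: ip_scale_left ip_scale_right)
  also have "\<dots> = complex_of_real (1 / sqrt ?r * (1 / sqrt ?r) * ?r)"
    by (simp only: c_def ip_self complex_cnj_complex_of_real of_real_mult mult.assoc)
  also have "1 / sqrt ?r * (1 / sqrt ?r) * ?r = 1"
    using \<open>?r > 0\<close> by (simp add: field_simps)
  finally show ?thesis using that by simp
qed

text \<open>The type \<open>'x\<close> may be infinite, so the space of all functions on it need not
  be finite-dimensional. Inside \<open>functions_on X\<close> every independent set is finite
  because the \<open>delta x\<close> with \<open>x\<close> in \<open>X\<close> span. Strict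
  monotonicity makes dimension the measure for the inductions over subspaces below.\<close>

lemma dim_strict_mono:
  assumes "finite X" and S: "fn.subspace S" and "S \<subset> T" and T: "T \<subseteq> functions_on X"
  shows "fn.dim S < fn.dim T"
proof -
  have "functions_on X \<subseteq> fn.span (delta ` X)"
  proof
    fix f :: "'a \<Rightarrow> complex"
    assume "f \<in> functions_on X"
    from functions_on_expand[OF assms(1) this]
    show "f \<in> fn.span (delta ` X)"
      by (metis (no_types, lifting) fn.span_base fn.span_scale fn.span_sum imageI)
  qed
  then have fin: "finite B" if "fn.independent B" "B \<subseteq> T" for B
    using fn.independent_span_bound[OF finite_imageI[OF assms(1)] that(1)] that(2) T by blast
  obtain B where B: "B \<subseteq> S" "fn.independent B" "S \<subseteq> fn.span B" "card B = fn.dim S"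
    by (rule fn.basis_exists)
  obtain f where f: "f \<in> T" "f \<notin> S"
    using assms(3) by blast
  then have nf: "f \<notin> fn.span B"
    using fn.span_minimal[OF B(1) S] by blast
  then have "fn.independent (insert f B)"
    using B(2) by (rule fn.independent_insertI)
  moreover have "insert f B \<subseteq> T" using f B(1) assms(3) by blast
  ultimately obtain C where C: "insert f B \<subseteq> C" "C \<subseteq> T" "fn.independent C" "T \<subseteq> fn.span C"
    using fn.maximal_independent_subset_extend by metis
  have "B \<subset> C" using C(1) nf fn.span_base by blast
  then have "card B < card C"
    using fin[OF C(3,2)] by (rule psubset_card_mono[rotated])
  then show ?thesis
    using B(4) fn.basis_card_eq_dim[OF C(2,4,3)] by simp
qed

section \<open>Orthonormal bases and the coordinates they give\<close>

lemma subspace_orthogonal: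
  assumes "fn.subspace U"
  shows "fn.subspace {f \<in> U. \<forall>m\<in>M. ip X f m = 0}"
  using assms by (auto simp: fn.subspace_def ip_add_left ip_scale_left)

text \<open>Only the values of \<open>e\<close> below \<open>n\<close> matter. Numbering the basis
  by an initial segment of the naturals matches the indexing of vectors and matrices, and
  \<open>n = 0\<close> covers the zero space.\<close>

locale orthonormal_basis =
  fixes X :: "'x set" and U :: "('x \<Rightarrow> complex) set" and n :: nat and e :: "nat \<Rightarrow> 'x \<Rightarrow> complex"
  assumes subspace: "fn.subspace U"
    and basis_in: "i < n \<Longrightarrow> e i \<in> U"
    and orthonormal: "i < n \<Longrightarrow> j < n \<Longrightarrow> ip X (e i) (e j) = (if i = j then 1 else 0)"
    and expand: "f \<in> U \<Longrightarrow> f = (\<Sum>i<n. fscale (ip X f (e i)) (e i))"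
begin

text \<open>The coordinate isomorphism from \<open>carrier_vec n\<close> onto \<open>U\<close>; its
  inverse sends \<open>f\<close> to the vector of pairings \<open>ip X f (e i)\<close>.\<close>

definition comb :: "complex vec \<Rightarrow> 'x \<Rightarrow> complex" where
  "comb w = (\<Sum>i<n. fscale (w $ i) (e i))"

text \<open>Column \<open>j\<close> holds the coordinates of \<open>T (e j)\<close>, so that
  composition of maps becomes the matrix product in the same order.\<close>

definition matrix_of :: "(('x \<Rightarrow> complex) \<Rightarrow> 'x \<Rightarrow> complex) \<Rightarrow> complex mat" where
  "matrix_of T = mat n n (\<lambda>(i, j). ip X (T (e j)) (e i))"

lemma matrix_of_carrier [simp]: "matrix_of T \<in> carrier_mat n n"
  by (simp add: matrix_of_def)

lemma eqI:
  assumes "f \<in> U" "h \<in> U" "\<And>i. i < n \<Longrightarrow> ip X f (e i) = ip X h (e i)"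
  shows "f = h"
  using expand[OF assms(1)] expand[OF assms(2)] assms(3) by simp

lemma comb_in: "comb w \<in> U"
  unfolding comb_def by (intro fn.subspace_sum fn.subspace_scale subspace basis_in) simp

lemma ip_comb: "i < n \<Longrightarrow> ip X (comb w) (e i) = w $ i"
  by (simp add: comb_def ip_sum_left ip_scale_left orthonormal if_distrib cong: if_cong)

lemma comb_add: "v \<in> carrier_vec n \<Longrightarrow> w \<in> carrier_vec n \<Longrightarrow> comb (v + w) = comb v + comb w"
  by (rule eqI) (simp_all add: comb_in fn.subspace_add[OF subspace] ip_comb ip_add_left)

lemma comb_smult: "w \<in> carrier_vec n \<Longrightarrow> comb (c \<cdot>\<^sub>v w) = fscale c (comb w)"
  by (rule eqI) (simp_all add: comb_in fn.subspace_scale[OF subspace] ip_comb ip_scale_left)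

lemma comb_zero: "comb (0\<^sub>v n) = 0"
  by (rule eqI) (simp_all add: comb_in fn.subspace_0[OF subspace] ip_comb)

lemma comb_inj: "v \<in> carrier_vec n \<Longrightarrow> w \<in> carrier_vec n \<Longrightarrow> comb v = comb w \<Longrightarrow> v = w"
  by (metis carrier_vecD eq_vecI ip_comb)

end

text \<open>Gram-Schmidt as an induction on dimension: split off a unit vector \<open>u\<close>,
  take a basis of the complement of \<open>u\<close> in \<open>U\<close>, which is strictly smaller
  because it misses \<open>u\<close>, and put \<open>u\<close> in front.\<close>

lemma orthonormal_basis_exists:
  assumes "finite X" "fn.subspace U" "U \<subseteq> functions_on X"
  shows "\<exists>n e. orthonormal_basis X U n e"
  using assms(2,3)
proof (induction "fn.dim U" arbitrary: U rule: less_induct)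
  case less
  show ?case
  proof (cases "U = {0}")
    case True
    have "orthonormal_basis X U 0 (\<lambda>_. 0)"
      by unfold_locales (use True in auto)
    then show ?thesis by blast
  next
    case False
    then obtain f where f: "f \<in> U" "f \<noteq> 0"
      using fn.subspace_0[OF less.prems(1)] by blast
    obtain c where c: "ip X (fscale c f) (fscale c f) = 1"
      using normalize_function[OF assms(1) _ f(2)] f(1) less.prems(2) by blast
    define u where "u = fscale c f"
    have u: "u \<in> U" "ip X u u = 1"
      using c f(1) less.prems(1) by (auto simp: u_def fn.subspace_scale)
    define U' where "U' = {f \<in> U. \<forall>m\<in>{u}. ip X f m = 0}"
    have U': "fn.subspace U'"
      unfolding U'_def by (rule subspace_orthogonal[OF less.prems(1)])
    have "u \<notin> U'" using u(2) by (simp add: U'_def)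
    then have "U' \<subset> U" using u(1) by (auto simp: U'_def)
    with less.hyps[OF dim_strict_mono[OF assms(1) U' _ less.prems(2)] U'] less.prems(2)
    obtain n e where "orthonormal_basis X U' n e" by blast
    then interpret e: orthonormal_basis X U' n e .
    have eU: "e i \<in> U" "ip X (e i) u = 0" "ip X u (e i) = 0" if "i < n" for i
      using e.basis_in[OF that] ip_commute[of X u "e i"] by (auto simp: U'_def)
    \<comment> \<open>\<open>case_nat u e\<close> has \<open>u\<close> at index 0 and the old basis
      shifted up by one.\<close>
    have "orthonormal_basis X U (Suc n) (case_nat u e)"
    proof
      show "fn.subspace U" by fact
      show "case_nat u e i \<in> U" if "i < Suc n" for i
        using that u(1) eU(1) by (cases i) auto
      show "ip X (case_nat u e i) (case_nat u e j) = (if i = j then 1 else 0)"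
        if "i < Suc n" "j < Suc n" for i j
        using that u(2) eU e.orthonormal by (auto split: nat.split)
    next
      fix f
      assume f: "f \<in> U"
      \<comment> \<open>Removing the component along \<open>u\<close> lands in the complement, where
        the inductive expansion applies; the pairings with the \<open>e i\<close> do not
        change.\<close>
      define h where "h = f - fscale (ip X f u) u"
      have h: "h \<in> U'"
        using f u less.prems(1)
        by (simp add: U'_def h_def fn.subspace_diff fn.subspace_scale ip_diff_left ip_scale_left)
      have "ip X h (e i) = ip X f (e i)" if "i < n" for i
        using eU(3)[OF that] by (simp add: h_def ip_diff_left ip_scale_left)
      then have "h = (\<Sum>i<n. fscale (ip X f (e i)) (e i))"
        using e.expand[OF h] by simp
      then have "f = fscale (ip X f u) u + (\<Sum>i<n. fscale (ip X f (e i)) (e i))"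
        by (simp add: h_def algebra_simps)
      then show "f = (\<Sum>i<Suc n. fscale (ip X f (case_nat u e i)) (case_nat u e i))"
        by (simp add: sum.lessThan_Suc_shift del: sum.lessThan_Suc)
    qed
    then show ?thesis by blast
  qed
qed

section \<open>Linear maps on sums, and their matrices\<close>

lemma linear_endo_zero: "fn.subspace V \<Longrightarrow> linear_endo V T \<Longrightarrow> T 0 = 0"
  by (metis fn.scale_zero_left fn.subspace_0 linear_endo_def)

lemma linear_endo_sum:
  assumes "fn.subspace V" "linear_endo V T" "\<And>i. i \<in> I \<Longrightarrow> f i \<in> V"
  shows "T (\<Sum>i\<in>I. f i) = (\<Sum>i\<in>I. T (f i))"
  using assms(3)
proof (induction I rule: infinite_finite_induct)
  case (insert x F)
  then have "f x \<in> V" "(\<Sum>i\<in>F. f i) \<in> V"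
    by (simp_all add: fn.subspace_sum[OF assms(1)])
  then have "T (f x + (\<Sum>i\<in>F. f i)) = T (f x) + T (\<Sum>i\<in>F. f i)"
    using assms(2) unfolding linear_endo_def by blast
  then show "T (\<Sum>i\<in>insert x F. f i) = (\<Sum>i\<in>insert x F. T (f i))"
    using insert by simp
next
  \<comment> \<open>Sums over an infinite index set default to 0, so this case is
    \<open>T 0 = 0\<close>.\<close>
  case (infinite I)
  then show "T (\<Sum>i\<in>I. f i) = (\<Sum>i\<in>I. T (f i))"
    using linear_endo_zero[OF assms(1,2)] by simp
next
  case empty
  show "T (\<Sum>i\<in>{}. f i) = (\<Sum>i\<in>{}. T (f i))"
    using linear_endo_zero[OF assms(1,2)] by simp
qed

lemma linear_endo_comb:
  assumes "fn.subspace V" "linear_endo V T" "\<And>i. i \<in> I \<Longrightarrow> f i \<in> V"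
  shows "T (\<Sum>i\<in>I. fscale (c i) (f i)) = (\<Sum>i\<in>I. fscale (c i) (T (f i)))"
  using linear_endo_sum[OF assms(1,2), of I "\<lambda>i. fscale (c i) (f i)"] assms
  by (simp add: fn.subspace_scale linear_endo_def)

context orthonormal_basis
begin

text \<open>Linearity is stated on an ambient space \<open>V\<close> and invariance on
  \<open>U\<close> separately: in the applications \<open>V\<close> is the whole function space of
  the group and \<open>U\<close> an invariant subspace of it.\<close>

context
  fixes V T
  assumes V: "fn.subspace V" "U \<subseteq> V" and T: "linear_endo V T" "T ` U \<subseteq> U"
begin

lemma apply_comb:
  assumes w: "w \<in> carrier_vec n"
  shows "T (comb w) = comb (matrix_of T *\<^sub>v w)"
proof (rule eqI)
  fix i
  assume i: "i < n"
  have "T (comb w) = (\<Sum>j<n. fscale (w $ j) (T (e j)))"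
    unfolding comb_def by (rule linear_endo_comb[OF V(1) T(1)]) (use V(2) basis_in in auto)
  then have "ip X (T (comb w)) (e i) = (\<Sum>j<n. ip X (T (e j)) (e i) * w $ j)"
    by (simp add: ip_sum_left ip_scale_left mult.commute)
  also have "\<dots> = (matrix_of T *\<^sub>v w) $ i"
    using i w by (simp add: matrix_of_def scalar_prod_def lessThan_atLeast0)
  finally show "ip X (T (comb w)) (e i) = ip X (comb (matrix_of T *\<^sub>v w)) (e i)"
    using ip_comb[OF i] by simp
qed (use T(2) comb_in in blast)+

lemma matrix_of_compose:
  assumes S: "S ` U \<subseteq> U"
  shows "matrix_of (\<lambda>f. T (S f)) = matrix_of T * matrix_of S"
proof (rule eq_matI)
  fix i j
  assume "i < dim_row (matrix_of T * matrix_of S)" "j < dim_col (matrix_of T * matrix_of S)"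
  then have ij: "i < n" "j < n" by (simp_all add: matrix_of_def)
  have "S (e j) = (\<Sum>k<n. fscale (ip X (S (e j)) (e k)) (e k))"
    using expand[of "S (e j)"] S basis_in[OF ij(2)] by blast
  then have "T (S (e j)) = (\<Sum>k<n. fscale (ip X (S (e j)) (e k)) (T (e k)))"
    using linear_endo_comb[OF V(1) T(1), of "{..<n}" e] V(2) basis_in by (metis lessThan_iff subsetD)
  then have "ip X (T (S (e j))) (e i) = (\<Sum>k<n. ip X (T (e k)) (e i) * ip X (S (e j)) (e k))"
    by (simp add: ip_sum_left ip_scale_left mult.commute)
  then show "matrix_of (\<lambda>f. T (S f)) $$ (i, j) = (matrix_of T * matrix_of S) $$ (i, j)"
    using ij by (simp add: matrix_of_def scalar_prod_def lessThan_atLeast0)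
qed (simp_all add: matrix_of_def)

text \<open>Over the complex numbers the characteristic polynomial, of degree \<open>n > 0\<close>,
  has a root. \<open>comb\<close> carries an eigenvector of the matrix to one of \<open>T\<close>
  inside \<open>U\<close>, nonzero by injectivity.\<close>

lemma eigenvector_exists:
  assumes "U \<noteq> {0}"
  obtains c f where "f \<in> U" "f \<noteq> 0" "T f = fscale c f"
proof -
  obtain f where "f \<in> U" "f \<noteq> 0"
    using assms fn.subspace_0[OF subspace] by blast
  then have "n > 0" using expand[of f] by (cases n) auto
  then have "\<not> constant (poly (char_poly (matrix_of T)))"
    using degree_monic_char_poly[OF matrix_of_carrier] by (simp add: constant_degree)
  then obtain c where "eigenvalue (matrix_of T) c"
    using fundamental_theorem_of_algebra eigenvalue_root_char_poly[OF matrix_of_carrier] by blast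
  then obtain v where v: "v \<in> carrier_vec n" "v \<noteq> 0\<^sub>v n" "matrix_of T *\<^sub>v v = c \<cdot>\<^sub>v v"
    unfolding eigenvalue_def eigenvector_def by (auto simp: matrix_of_def)
  show ?thesis
  proof
    show "comb v \<in> U" by (rule comb_in)
    show "comb v \<noteq> 0"
      using comb_inj[OF v(1) zero_carrier_vec] v(2) comb_zero by auto
    show "T (comb v) = fscale c (comb v)"
      using apply_comb[OF v(1)] comb_smult[OF v(1)] v(3) by simp
  qed
qed

end

end

section \<open>Invariant subspaces and complete reducibility\<close>

text \<open>The set of maps is a parameter because two choices are used: all translations, giving
  biinvariant subspaces, and right translations alone, giving subrepresentations of the right
  regular representation.\<close>

definition invariant_subspace ::
  "(('x \<Rightarrow> complex) \<Rightarrow> 'x \<Rightarrow> complex) set \<Rightarrow> ('x \<Rightarrow> complex) set \<Rightarrow> bool" where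
  "invariant_subspace \<T> U \<longleftrightarrow> fn.subspace U \<and> (\<forall>T\<in>\<T>. T ` U \<subseteq> U)"

definition minimal_invariant ::
  "(('x \<Rightarrow> complex) \<Rightarrow> 'x \<Rightarrow> complex) set \<Rightarrow> ('x \<Rightarrow> complex) set \<Rightarrow> bool" where
  "minimal_invariant \<T> M \<longleftrightarrow> invariant_subspace \<T> M \<and> M \<noteq> {0} \<and>
     (\<forall>U. invariant_subspace \<T> U \<and> U \<subseteq> M \<longrightarrow> U = {0} \<or> U = M)"

text \<open>Descent on dimension: a space that is not minimal contains a strictly smaller nonzero
  invariant one.\<close>

lemma minimal_invariant_exists:
  assumes "finite X" "invariant_subspace \<T> U" "U \<noteq> {0}" "U \<subseteq> functions_on X"
  shows "\<exists>M\<subseteq>U. minimal_invariant \<T> M"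
  using assms(2-)
proof (induction "fn.dim U" arbitrary: U rule: less_induct)
  case less
  show ?case
  proof (cases "minimal_invariant \<T> U")
    case False
    then obtain U' where U': "invariant_subspace \<T> U'" "U' \<subset> U" "U' \<noteq> {0}"
      using less.prems by (auto simp: minimal_invariant_def)
    have "fn.dim U' < fn.dim U"
      using dim_strict_mono[OF assms(1) _ U'(2) less.prems(3)] U'(1)
      by (simp add: invariant_subspace_def)
    then show ?thesis
      using less.hyps[OF _ U'(1,3)] U'(2) less.prems(3) by (meson psubset_imp_subset subset_trans)
  qed auto
qed

lemma internal_direct_sum_insert:
  assumes ds: "internal_direct_sum U' I W" and i: "i \<notin> I" "fn.subspace (W i)"
    and U: "U = {m + u | m u. m \<in> W i \<and> u \<in> U'}" and int: "W i \<inter> U' \<subseteq> {0}"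
  shows "internal_direct_sum U (insert i I) W"
proof -
  have fin: "finite I" and sub: "\<And>j. j \<in> I \<Longrightarrow> fn.subspace (W j)"
    and U': "U' = {\<Sum>j\<in>I. w j | w. \<forall>j\<in>I. w j \<in> W j}"
    and ind: "\<And>w j. \<forall>j\<in>I. w j \<in> W j \<Longrightarrow> (\<Sum>j\<in>I. w j) = 0 \<Longrightarrow> j \<in> I \<Longrightarrow> w j = 0"
    using ds unfolding internal_direct_sum_def by blast+
  have "U \<subseteq> {\<Sum>j\<in>insert i I. w j | w. \<forall>j\<in>insert i I. w j \<in> W j}"
  proof
    fix f
    assume "f \<in> U"
    then obtain m w where mw: "f = m + (\<Sum>j\<in>I. w j)" "m \<in> W i" "\<forall>j\<in>I. w j \<in> W j"
      unfolding U U' by blast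
    \<comment> \<open>Since \<open>i\<close> is not in \<open>I\<close>, setting the component at
      \<open>i\<close> to \<open>m\<close> leaves the sum over \<open>I\<close> alone.\<close>
    have "(\<Sum>j\<in>I. (w(i := m)) j) = (\<Sum>j\<in>I. w j)"
      using i(1) by (intro sum.cong) auto
    then have "f = (\<Sum>j\<in>insert i I. (w(i := m)) j)"
      using mw(1) fin i(1) by simp
    moreover have "\<forall>j\<in>insert i I. (w(i := m)) j \<in> W j" using mw by simp
    ultimately show "f \<in> {\<Sum>j\<in>insert i I. w j | w. \<forall>j\<in>insert i I. w j \<in> W j}" by blast
  qed
  moreover have "{\<Sum>j\<in>insert i I. w j | w. \<forall>j\<in>insert i I. w j \<in> W j} \<subseteq> U"
    using fin i(1) unfolding U U' by auto
  moreover have "w j = 0"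
    if w: "\<forall>j\<in>insert i I. w j \<in> W j" "(\<Sum>j\<in>insert i I. w j) = 0" "j \<in> insert i I" for w j
  proof -
    have s: "(\<Sum>j\<in>I. w j) \<in> U'" unfolding U' using w(1) by blast
    have z: "w i + (\<Sum>j\<in>I. w j) = 0" using w(2) fin i(1) by simp
    then have "(\<Sum>j\<in>I. w j) = - w i" by (simp add: eq_neg_iff_add_eq_0 add.commute)
    moreover have "- w i \<in> W i" using w(1) fn.subspace_neg[OF i(2)] by simp
    \<comment> \<open>The partial sum equals \<open>- w i\<close>, so it lies in both
      \<open>W i\<close> and \<open>U'\<close>, which meet only in 0.\<close>
    ultimately have "(\<Sum>j\<in>I. w j) = 0" using s int by auto
    moreover from this have "w i = 0" using z by simp
    ultimately show ?thesis using ind[of w j] w(1,3) by auto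
  qed
  ultimately show ?thesis
    unfolding internal_direct_sum_def using fin sub i(2) by (intro conjI) blast+
qed

lemma internal_direct_sum_component:
  assumes "internal_direct_sum U I W" "i \<in> I"
  shows "W i \<subseteq> U"
proof
  fix f
  assume f: "f \<in> W i"
  have I: "finite I" "\<And>j. j \<in> I \<Longrightarrow> 0 \<in> W j"
    using assms(1) fn.subspace_0 unfolding internal_direct_sum_def by blast+
  have "f = (\<Sum>j\<in>I. if j = i then f else 0)" using I(1) assms(2) by simp
  moreover have "\<forall>j\<in>I. (if j = i then f else 0) \<in> W j" using f I(2) by simp
  ultimately have "f \<in> {\<Sum>i\<in>I. w i | w. \<forall>i\<in>I. w i \<in> W i}"
    by (intro CollectI exI[of _ "\<lambda>j. if j = i then f else 0"]) simp
  moreover have "U = {\<Sum>i\<in>I. w i | w. \<forall>i\<in>I. w i \<in> W i}"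
    using assms(1) unfolding internal_direct_sum_def by (elim conjE)
  ultimately show "f \<in> U" by (simp only:)
qed

text \<open>Maschke's argument by orthogonal complements. Closure of the set of maps under adjoints
  makes the complement of an invariant \<open>M\<close> invariant, so a minimal \<open>M\<close> can
  be split off and the induction continues on its complement.\<close>

lemma complete_reducibility:
  assumes "finite X" and adj: "\<And>T. T \<in> \<T> \<Longrightarrow> \<exists>S\<in>\<T>. \<forall>f h. ip X (T f) h = ip X f (S h)"
    and "invariant_subspace \<T> U" "U \<subseteq> functions_on X"
  shows "\<exists>\<W>. (\<forall>W\<in>\<W>. minimal_invariant \<T> W) \<and> internal_direct_sum U \<W> (\<lambda>W. W)"
  using assms(3,4)
proof (induction "fn.dim U" arbitrary: U rule: less_induct)
  case less
  note U = less.prems(1)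
  have subU: "fn.subspace U" using U by (simp add: invariant_subspace_def)
  show ?case
  proof (cases "U = {0}")
    case True
    have "internal_direct_sum U {} (\<lambda>W. W)"
      by (auto simp: internal_direct_sum_def True)
    then show ?thesis by blast
  next
    case False
    obtain M where M: "M \<subseteq> U" "minimal_invariant \<T> M"
      using minimal_invariant_exists[OF assms(1) U False less.prems(2)] by blast
    have invM: "invariant_subspace \<T> M" "M \<noteq> {0}" and subM: "fn.subspace M"
      using M(2) by (auto simp: minimal_invariant_def invariant_subspace_def)
    \<comment> \<open>The orthogonal complement of \<open>M\<close> within \<open>U\<close>.\<close>
    define U' where "U' = {f \<in> U. \<forall>m\<in>M. ip X f m = 0}"
    have subU': "fn.subspace U'"
      unfolding U'_def by (rule subspace_orthogonal[OF subU])
    have U': "invariant_subspace \<T> U'"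
      unfolding invariant_subspace_def
    proof (intro conjI ballI subsetI subU')
      fix T f
      assume T: "T \<in> \<T>" and "f \<in> T ` U'"
      then obtain h where h: "f = T h" "h \<in> U'" by blast
      obtain S where S: "S \<in> \<T>" "\<And>f h. ip X (T f) h = ip X f (S h)"
        using adj[OF T] by blast
      have "f \<in> U" using h T U by (auto simp: U'_def invariant_subspace_def)
      moreover have "ip X f m = 0" if "m \<in> M" for m
      proof -
        have "S m \<in> M" using S(1) invM(1) that by (auto simp: invariant_subspace_def)
        then show ?thesis using h S(2) by (simp add: U'_def)
      qed
      ultimately show "f \<in> U'" by (simp add: U'_def)
    qed
    have int: "M \<inter> U' \<subseteq> {0}"
      using M(1) less.prems(2) ip_self_eq_0[OF assms(1)] by (auto simp: U'_def)
    obtain m where "m \<in> M" "m \<noteq> 0"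
      using invM(2) fn.subspace_0[OF subM] by blast
    then have "U' \<subset> U" using int M(1) by (auto simp: U'_def)
    from less.hyps[OF dim_strict_mono[OF assms(1) subU' this less.prems(2)] U']
    obtain \<W> where W: "\<forall>W\<in>\<W>. minimal_invariant \<T> W" "internal_direct_sum U' \<W> (\<lambda>W. W)"
      using \<open>U' \<subset> U\<close> less.prems(2) by blast
    \<comment> \<open>The summands index themselves, so \<open>M\<close> has to be a new index. If
      it were already a summand it would lie in \<open>U'\<close>, against the nonzero
      \<open>m\<close>.\<close>
    have "M \<notin> \<W>"
      using internal_direct_sum_component[OF W(2), of M] int \<open>m \<in> M\<close> \<open>m \<noteq> 0\<close> by blast
    moreover have "U = {m + u | m u. m \<in> M \<and> u \<in> U'}"
    proof (intro equalityI subsetI)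
      fix f
      assume f: "f \<in> U"
      obtain n e where "orthonormal_basis X M n e"
        using orthonormal_basis_exists[OF assms(1) subM] M(1) less.prems(2) by blast
      then interpret orthonormal_basis X M n e .
      \<comment> \<open>The orthogonal projection of \<open>f\<close> to \<open>M\<close>; it has
        the same pairings with the basis of \<open>M\<close> as \<open>f\<close>.\<close>
      define p where "p = comb (vec n (\<lambda>i. ip X f (e i)))"
      have "ip X (f - p) m = 0" if "m \<in> M" for m
      proof -
        have "ip X (e i) (f - p) = 0" if "i < n" for i
          using ip_comb[OF that] that ip_commute[of X "e i" "f - p"]
          by (simp add: p_def ip_diff_left)
        then have "ip X m (f - p) = 0"
          by (subst expand[OF that]) (simp add: ip_sum_left ip_scale_left)
        then show ?thesis using ip_commute[of X "f - p" m] by simp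
      qed
      moreover have "f - p \<in> U"
        using comb_in M(1) f subU by (auto simp: p_def intro: fn.subspace_diff)
      ultimately have "f - p \<in> U'" by (simp add: U'_def)
      moreover have "p \<in> M" by (simp add: p_def comb_in)
      moreover have "f = p + (f - p)" by simp
      ultimately show "f \<in> {m + u | m u. m \<in> M \<and> u \<in> U'}" by blast
    qed (use M(1) subU in \<open>auto simp: U'_def intro: fn.subspace_add\<close>)
    ultimately have "internal_direct_sum U (insert M \<W>) (\<lambda>W. W)"
      using internal_direct_sum_insert[OF W(2), of M U] subM int by blast
    then show ?thesis using W(1) M(2) by blast
  qed
qed

section \<open>Eigenspaces and diagonalisable maps\<close>

lemma eigenspace_subspace:
  assumes "fn.subspace V" "linear_endo V L"
  shows "fn.subspace (eigenspace V L c)"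
proof (rule fn.subspaceI)
  show "0 \<in> eigenspace V L c"
    using linear_endo_zero[OF assms] fn.subspace_0[OF assms(1)] by (simp add: eigenspace_def)
next
  fix f h
  assume fh: "f \<in> eigenspace V L c" "h \<in> eigenspace V L c"
  then have "L (f + h) = L f + L h"
    using assms(2) unfolding linear_endo_def eigenspace_def by blast
  then show "f + h \<in> eigenspace V L c"
    using fh by (simp add: eigenspace_def fn.subspace_add[OF assms(1)] fn.scale_right_distrib)
next
  fix d f
  assume f: "f \<in> eigenspace V L c"
  then have "L (fscale d f) = fscale d (L f)"
    using assms(2) unfolding linear_endo_def eigenspace_def by blast
  then show "fscale d f \<in> eigenspace V L c"
    using f by (simp add: eigenspace_def fn.subspace_scale[OF assms(1)] mult.commute)
qed

text \<open>Applying \<open>L\<close> to the relation and subtracting \<open>d\<close> times the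
  relation removes \<open>w d\<close> and multiplies every other \<open>w c\<close> by
  \<open>c - d\<close>, which is nonzero; the shorter relation is handled by induction.\<close>

lemma eigenvectors_independent:
  assumes V: "fn.subspace V" and L: "linear_endo V L" and "finite C"
    and "\<forall>c\<in>C. w c \<in> eigenspace V L c" "(\<Sum>c\<in>C. w c) = 0"
  shows "\<forall>c\<in>C. w c = 0"
  using assms(3-)
proof (induction C arbitrary: w)
  case (insert d C)
  have w: "w c \<in> V" "L (w c) = fscale c (w c)" if "c \<in> insert d C" for c
    using insert.prems(1) that by (auto simp: eigenspace_def)
  have total: "(\<Sum>c\<in>insert d C. w c) = 0" by (rule insert.prems(2))
  then have s: "w d + (\<Sum>c\<in>C. w c) = 0" using insert.hyps by simp
  have "L (\<Sum>c\<in>insert d C. w c) = (\<Sum>c\<in>insert d C. L (w c))"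
    by (rule linear_endo_sum[OF V L]) (rule w)
  also have "\<dots> = (\<Sum>c\<in>insert d C. fscale c (w c))"
    using w(2) by (rule sum.cong[OF refl])
  finally have "fscale d (w d) + (\<Sum>c\<in>C. fscale c (w c)) = 0"
    using insert.hyps total linear_endo_zero[OF V L] by simp
  moreover have "fscale d (w d) + (\<Sum>c\<in>C. fscale d (w c)) = 0"
    using arg_cong[OF s, of "fscale d"] by (simp add: fn.scale_right_distrib fn.scale_sum_right)
  ultimately have "(\<Sum>c\<in>C. fscale c (w c)) = (\<Sum>c\<in>C. fscale d (w c))"
    by (metis add_left_cancel)
  then have "(\<Sum>c\<in>C. fscale (c - d) (w c)) = 0"
    by (simp add: fn.scale_left_diff_distrib sum_subtractf)
  moreover have "\<forall>c\<in>C. fscale (c - d) (w c) \<in> eigenspace V L c"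
    using insert.prems(1) fn.subspace_scale[OF eigenspace_subspace[OF V L]] by simp
  ultimately have "\<forall>c\<in>C. fscale (c - d) (w c) = 0"
    using insert.IH[of "\<lambda>c. fscale (c - d) (w c)"] by blast
  then have "\<forall>c\<in>C. w c = 0" using insert.hyps(2) by auto
  then show "\<forall>c\<in>insert d C. w c = 0" using s by simp
qed simp

text \<open>A map that is scalar on each summand of a decomposition is diagonalisable: collecting
  the summands with equal scalar writes any vector as a sum of eigenvectors.\<close>

lemma eigenspaces_direct_sum:
  assumes V: "fn.subspace V" and L: "linear_endo V L"
    and ds: "internal_direct_sum V I W"
    and scal: "\<And>i. i \<in> I \<Longrightarrow> \<exists>c. \<forall>f\<in>W i. L f = fscale c f"
  shows "internal_direct_sum V (eigenvalues V L) (eigenspace V L)"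
proof -
  obtain c where c: "\<And>i f. i \<in> I \<Longrightarrow> f \<in> W i \<Longrightarrow> L f = fscale (c i) f"
    using scal by metis
  have fin: "finite I" and sub: "\<And>j. j \<in> I \<Longrightarrow> fn.subspace (W j)"
    and Veq: "V = {\<Sum>j\<in>I. w j | w. \<forall>j\<in>I. w j \<in> W j}"
    and ind: "\<And>w j. \<forall>j\<in>I. w j \<in> W j \<Longrightarrow> (\<Sum>j\<in>I. w j) = 0 \<Longrightarrow> j \<in> I \<Longrightarrow> w j = 0"
    using ds unfolding internal_direct_sum_def by blast+
  have WV: "W i \<subseteq> V" if "i \<in> I" for i
    by (rule internal_direct_sum_component[OF ds that])
  have ev_sub: "eigenvalues V L \<subseteq> c ` I"
  proof
    fix d
    assume "d \<in> eigenvalues V L"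
    then obtain f where f: "f \<in> V" "L f = fscale d f" "f \<noteq> 0"
      by (auto simp: eigenvalues_def eigenspace_def)
    obtain w where w: "f = (\<Sum>j\<in>I. w j)" "\<forall>j\<in>I. w j \<in> W j" using f(1) Veq by blast
    have "L f = (\<Sum>j\<in>I. L (w j))"
      unfolding w(1) by (rule linear_endo_sum[OF V L]) (use w(2) WV in blast)
    also have "\<dots> = (\<Sum>j\<in>I. fscale (c j) (w j))"
      using c w(2) by (intro sum.cong) auto
    \<comment> \<open>Directness kills each term separately, and a component \<open>w j\<close> that
      is nonzero then forces \<open>d = c j\<close>.\<close>
    finally have "(\<Sum>j\<in>I. fscale (c j - d) (w j)) = 0"
      using f(2) w(1) by (simp add: fn.scale_left_diff_distrib sum_subtractf fn.scale_sum_right)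
    moreover have "\<forall>j\<in>I. fscale (c j - d) (w j) \<in> W j"
      using w(2) sub fn.subspace_scale by blast
    ultimately have z: "fscale (c j - d) (w j) = 0" if "j \<in> I" for j
      using ind[of "\<lambda>j. fscale (c j - d) (w j)"] that by blast
    obtain j where "j \<in> I" "w j \<noteq> 0" using f(3) w(1) by (metis sum.neutral)
    then show "d \<in> c ` I" using z by fastforce
  qed
  then have fin_ev: "finite (eigenvalues V L)" using fin finite_surj by blast
  have "V \<subseteq> {\<Sum>d\<in>eigenvalues V L. w d | w. \<forall>d\<in>eigenvalues V L. w d \<in> eigenspace V L d}"
  proof
    fix f
    assume "f \<in> V"
    then obtain w where w: "f = (\<Sum>j\<in>I. w j)" "\<forall>j\<in>I. w j \<in> W j" using Veq by blast
    define v where "v d = (\<Sum>j\<in>{j \<in> I. c j = d}. w j)" for d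
    have v: "v d \<in> eigenspace V L d" for d
      unfolding v_def
    proof (rule fn.subspace_sum[OF eigenspace_subspace[OF V L]])
      fix j
      assume "j \<in> {j \<in> I. c j = d}"
      then show "w j \<in> eigenspace V L d" using w(2) c WV unfolding eigenspace_def by blast
    qed
    have "f = (\<Sum>d\<in>c ` I. v d)"
      unfolding v_def w(1) by (rule sum.image_gen[OF fin])
    \<comment> \<open>A zero summand may carry a scalar that is not an eigenvalue; for such
      \<open>d\<close> the eigenspace is trivial and \<open>v d\<close> vanishes.\<close>
    also have "\<dots> = (\<Sum>d\<in>eigenvalues V L. v d)"
      using v fin ev_sub by (intro sum.mono_neutral_right) (auto simp: eigenvalues_def)
    finally show "f \<in> {\<Sum>d\<in>eigenvalues V L. w d | w. \<forall>d\<in>eigenvalues V L. w d \<in> eigenspace V L d}"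
      using v by blast
  qed
  moreover have "{\<Sum>d\<in>eigenvalues V L. w d | w. \<forall>d\<in>eigenvalues V L. w d \<in> eigenspace V L d} \<subseteq> V"
    by (auto simp: eigenspace_def intro!: fn.subspace_sum[OF V])
  ultimately show ?thesis
    unfolding internal_direct_sum_def
    using fin_ev eigenspace_subspace[OF V L] eigenvectors_independent[OF V L fin_ev] by blast
qed

section \<open>Translations on a finite group\<close>

lemma coeff_space_subset: "coeff_space G n \<rho> \<subseteq> group_functions G"
  unfolding coeff_space_def
  by (rule fn.span_minimal[OF _ subspace_functions_on])
    (auto simp: functions_on_def matrix_coeff_def)

lemma matrix_rep_carrier: "matrix_rep G n \<rho> \<Longrightarrow> g \<in> carrier G \<Longrightarrow> \<rho> g \<in> carrier_mat n n"
  by (auto simp: matrix_rep_def hom_def units_of_def Units_def ring_mat_simps)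

lemma matrix_rep_mult:
  "matrix_rep G n \<rho> \<Longrightarrow> g \<in> carrier G \<Longrightarrow> h \<in> carrier G \<Longrightarrow> \<rho> (g \<otimes>\<^bsub>G\<^esub> h) = \<rho> g * \<rho> h"
  by (auto simp: matrix_rep_def hom_def units_of_def ring_mat_simps)

locale finite_group_functions = group G for G :: "('g, 'm) monoid_scheme" (structure) +
  assumes fin: "finite (carrier G)"
begin

text \<open>The value 0 off the carrier keeps the result in \<open>group_functions G\<close> for
  every \<open>f\<close>. Composing two \<open>ltr\<close> reverses the order of the group elements,
  whereas \<open>rtr\<close> preserves it, which is why representations are built from
  \<open>rtr\<close>.\<close>

definition ltr :: "'g \<Rightarrow> ('g \<Rightarrow> complex) \<Rightarrow> 'g \<Rightarrow> complex" where
  "ltr a f = (\<lambda>g. if g \<in> carrier G then f (a \<otimes> g) else 0)"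

definition rtr :: "'g \<Rightarrow> ('g \<Rightarrow> complex) \<Rightarrow> 'g \<Rightarrow> complex" where
  "rtr a f = (\<lambda>g. if g \<in> carrier G then f (g \<otimes> a) else 0)"

definition translation_maps :: "(('g \<Rightarrow> complex) \<Rightarrow> 'g \<Rightarrow> complex) set" where
  "translation_maps = ltr ` carrier G \<union> rtr ` carrier G"

lemma translation_add: "t \<in> translation_maps \<Longrightarrow> t (f + h) = t f + t h"
  by (auto simp: translation_maps_def ltr_def rtr_def fun_eq_iff)

lemma translation_scale: "t \<in> translation_maps \<Longrightarrow> t (fscale c f) = fscale c (t f)"
  by (auto simp: translation_maps_def ltr_def rtr_def fscale_def fun_eq_iff)

lemma translation_zero: "t \<in> translation_maps \<Longrightarrow> t 0 = 0"
  by (auto simp: translation_maps_def ltr_def rtr_def fun_eq_iff)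

lemma translation_in: "t \<in> translation_maps \<Longrightarrow> t f \<in> group_functions G"
  by (auto simp: translation_maps_def ltr_def rtr_def functions_on_def)

lemma translation_linear_endo: "t \<in> translation_maps \<Longrightarrow> linear_endo (group_functions G) t"
  unfolding linear_endo_def by (intro conjI ballI allI translation_in translation_add translation_scale)

text \<open>Substituting \<open>a \<otimes> g\<close> for the summation variable; thus the adjoint
  of a translation is the translation by the inverse.\<close>

lemma ip_ltr:
  assumes a: "a \<in> carrier G"
  shows "ip (carrier G) (ltr a f) h = ip (carrier G) f (ltr (inv a) h)"
  unfolding ip_def
  by (rule sum.reindex_bij_witness[where i = "\<lambda>g. inv a \<otimes> g" and j = "\<lambda>g. a \<otimes> g"])
    (use a in \<open>auto simp: ltr_def m_assoc[symmetric]\<close>)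

lemma ip_rtr:
  assumes a: "a \<in> carrier G"
  shows "ip (carrier G) (rtr a f) h = ip (carrier G) f (rtr (inv a) h)"
  unfolding ip_def
  by (rule sum.reindex_bij_witness[where i = "\<lambda>g. g \<otimes> inv a" and j = "\<lambda>g. g \<otimes> a"])
    (use a in \<open>auto simp: rtr_def m_assoc\<close>)

lemma translation_adjoint:
  assumes "t \<in> translation_maps"
  shows "\<exists>s\<in>translation_maps. \<forall>f h. ip (carrier G) (t f) h = ip (carrier G) f (s h)"
proof -
  consider a where "a \<in> carrier G" "t = ltr a" | a where "a \<in> carrier G" "t = rtr a"
    using assms by (auto simp: translation_maps_def)
  then show ?thesis
  proof cases
    case 1
    then show ?thesis
      by (intro bexI[of _ "ltr (inv a)"]) (simp_all add: ip_ltr translation_maps_def)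
  next
    case 2
    then show ?thesis
      by (intro bexI[of _ "rtr (inv a)"]) (simp_all add: ip_rtr translation_maps_def)
  qed
qed

section \<open>Bicomodule maps as maps commuting with translations\<close>

lemma bicomodule_map_iff:
  assumes L: "linear_endo (group_functions G) L"
  shows "bicomodule_map G (left_coregular G) (right_coregular G) L \<longleftrightarrow>
    (\<forall>t\<in>translation_maps. \<forall>f\<in>group_functions G. L (t f) = t (L f))"
proof -
  have Lf: "L f \<in> group_functions G" if "f \<in> group_functions G" for f
    using L that by (simp add: linear_endo_def)
  have delta: "delta x \<in> group_functions G" if "x \<in> carrier G" for x
    using that by (auto simp: functions_on_def delta_def)
  have expand: "L f x = (\<Sum>y\<in>carrier G. f y * L (delta y) x)" if "f \<in> group_functions G" for f x
    using arg_cong[OF linear_endo_expand[OF fin L that], of "\<lambda>F. F x"]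
    by (simp add: sum_fun_apply fscale_def)
  \<comment> \<open>The coproduct of \<open>f\<close> at \<open>(x, y)\<close> is
    \<open>f (x \<otimes> y)\<close>. The identity on the first leg selects \<open>x = a\<close>,
    and what remains is the expansion of \<open>L\<close> on the function
    \<open>ltr a f\<close>.\<close>
  have left: "tensor_map G id L (coproduct G f) (a, b) =
      (if a \<in> carrier G then L (ltr a f) b else 0)" for f a b
  proof -
    have "tensor_map G id L (coproduct G f) (a, b)
        = (\<Sum>x\<in>carrier G. \<Sum>y\<in>carrier G. f (x \<otimes> y) * ((if a = x then 1 else 0) * L (delta y) b))"
      unfolding tensor_map_def sum_fun_apply sum.cartesian_product
      by (rule sum.cong)
        (auto simp: fscale_def tensor_def coproduct_apply[OF is_group fin] delta_def)
    also have "\<dots> = (\<Sum>x\<in>carrier G. if a = x then \<Sum>y\<in>carrier G. f (x \<otimes> y) * L (delta y) b else 0)"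
      by (rule sum.cong) auto
    also have "\<dots> = (if a \<in> carrier G then L (ltr a f) b else 0)"
      using fin translation_in[of "ltr a"]
      by (auto simp: expand translation_maps_def ltr_def functions_on_def intro!: sum.cong)
    finally show ?thesis .
  qed
  have right: "tensor_map G L id (coproduct G f) (a, b) =
      (if b \<in> carrier G then L (rtr b f) a else 0)" for f a b
  proof -
    have "tensor_map G L id (coproduct G f) (a, b)
        = (\<Sum>x\<in>carrier G. \<Sum>y\<in>carrier G. f (x \<otimes> y) * (L (delta x) a * (if b = y then 1 else 0)))"
      unfolding tensor_map_def sum_fun_apply sum.cartesian_product
      by (rule sum.cong)
        (auto simp: fscale_def tensor_def coproduct_apply[OF is_group fin] delta_def)
    also have "\<dots> = (\<Sum>x\<in>carrier G. if b \<in> carrier G then f (x \<otimes> b) * L (delta x) a else 0)"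
      using fin by (intro sum.cong refl) (simp add: if_distrib cong: if_cong)
    also have "\<dots> = (if b \<in> carrier G then L (rtr b f) a else 0)"
      by (auto simp: expand rtr_def functions_on_def intro!: sum.cong)
    finally show ?thesis .
  qed
  \<comment> \<open>At \<open>(a, b)\<close> the left side is \<open>L f (a \<otimes> b)\<close>,
    that is \<open>ltr a (L f) b\<close>, so comparing values gives commutation with
    \<open>ltr a\<close>. Outside the carrier both sides are 0.\<close>
  have "coproduct G (L f) = tensor_map G id L (coproduct G f) \<longleftrightarrow>
      (\<forall>a\<in>carrier G. L (ltr a f) = ltr a (L f))" if f: "f \<in> group_functions G" for f
  proof -
    have "L (ltr a f) b = 0" if "b \<notin> carrier G" for a b
      using Lf[of "ltr a f"] that by (simp add: functions_on_def ltr_def)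
    then show ?thesis
      by (auto simp: fun_eq_iff coproduct_apply[OF is_group fin] left ltr_def)
  qed
  moreover have "coproduct G (L f) = tensor_map G L id (coproduct G f) \<longleftrightarrow>
      (\<forall>a\<in>carrier G. L (rtr a f) = rtr a (L f))" if f: "f \<in> group_functions G" for f
  proof -
    have "L (rtr a f) b = 0" if "b \<notin> carrier G" for a b
      using Lf[of "rtr a f"] that by (simp add: functions_on_def rtr_def)
    then show ?thesis
      by (auto simp: fun_eq_iff coproduct_apply[OF is_group fin] right rtr_def)
  qed
  ultimately show ?thesis
    using L by (auto simp: bicomodule_map_def translation_maps_def)
qed

text \<open>By linearity it suffices to translate the spanning coefficients, and multiplicativity of
  \<open>\<rho>\<close> expands each translate in coefficients again.\<close>

lemma coeff_space_invariant:
  assumes "matrix_rep G n \<rho>"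
  shows "invariant_subspace translation_maps (coeff_space G n \<rho>)"
  unfolding invariant_subspace_def
proof (intro conjI ballI subsetI)
  show "fn.subspace (coeff_space G n \<rho>)" by (simp add: coeff_space_def)
next
  fix t f
  assume t: "t \<in> translation_maps" and "f \<in> t ` coeff_space G n \<rho>"
  then obtain h where h: "h \<in> coeff_space G n \<rho>" "f = t h" by blast
  note rep = matrix_rep_carrier[OF assms] matrix_rep_mult[OF assms]
  have entry: "\<rho> (a \<otimes> b) $$ (i, j) = (\<Sum>k<n. \<rho> a $$ (i, k) * \<rho> b $$ (k, j))"
    if "i < n" "j < n" "a \<in> carrier G" "b \<in> carrier G" for i j a b
    using that rep(1)[of a] rep(1)[of b]
    by (simp add: rep(2) scalar_prod_def lessThan_atLeast0)
  have gen: "matrix_coeff G \<rho> i j \<in> coeff_space G n \<rho>" if "i < n" "j < n" for i j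
    using that by (auto simp: coeff_space_def intro!: fn.span_base)
  have base: "t (matrix_coeff G \<rho> i j) \<in> coeff_space G n \<rho>" if ij: "i < n" "j < n" for i j
  proof -
    have sub: "fn.subspace (coeff_space G n \<rho>)" by (simp add: coeff_space_def)
    consider a where "a \<in> carrier G" "t = ltr a" | a where "a \<in> carrier G" "t = rtr a"
      using t by (auto simp: translation_maps_def)
    then show ?thesis
    proof cases
      case 1
      \<comment> \<open>Left translation mixes the row indices and keeps the column.\<close>
      have "t (matrix_coeff G \<rho> i j) = (\<Sum>k<n. fscale (\<rho> a $$ (i, k)) (matrix_coeff G \<rho> k j))"
        using ij 1 by (auto simp: fun_eq_iff sum_fun_apply fscale_def matrix_coeff_def ltr_def entry)
      then show ?thesis
        using gen ij by (auto intro!: fn.subspace_sum[OF sub] fn.subspace_scale[OF sub])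
    next
      case 2
      \<comment> \<open>Right translation mixes the column indices and keeps the row.\<close>
      have "t (matrix_coeff G \<rho> i j) = (\<Sum>k<n. fscale (\<rho> a $$ (k, j)) (matrix_coeff G \<rho> i k))"
        using ij 2 by (auto simp: fun_eq_iff sum_fun_apply fscale_def matrix_coeff_def rtr_def entry
            mult.commute)
      then show ?thesis
        using gen ij by (auto intro!: fn.subspace_sum[OF sub] fn.subspace_scale[OF sub])
    qed
  qed
  have "t h \<in> coeff_space G n \<rho>"
    using h(1) unfolding coeff_space_def
  proof (induction rule: fn.span_induct_alt)
    case base
    show "t 0 \<in> fn.span {matrix_coeff G \<rho> i j | i j. i < n \<and> j < n}"
      by (simp add: translation_zero[OF t] fn.span_zero)
  next
    case (step c x y)
    then show "t (fscale c x + y) \<in> fn.span {matrix_coeff G \<rho> i j | i j. i < n \<and> j < n}"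
      unfolding translation_add[OF t] translation_scale[OF t] using base
      by (auto simp: coeff_space_def intro!: fn.span_add fn.span_scale)
  qed
  then show "f \<in> coeff_space G n \<rho>" by (simp add: h(2))
qed

section \<open>Maps commuting with all translations\<close>

lemma commuting_map_preserves_invariant:
  assumes L: "linear_endo (group_functions G) L"
    and comm: "\<forall>t\<in>translation_maps. \<forall>f\<in>group_functions G. L (t f) = t (L f)"
    and M: "invariant_subspace translation_maps M" "M \<subseteq> group_functions G" and f: "f \<in> M"
  shows "L f \<in> M"
proof -
  have fG: "f \<in> group_functions G" using f M(2) by blast
  \<comment> \<open>Commuting with right translations determines \<open>L\<close> by its values at
    \<open>\<one>\<close>: \<open>L f g\<close> equals \<open>L (rtr g f) \<one>\<close>, and
    expanding \<open>rtr g f\<close> in the \<open>delta x\<close> gives the terms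
    \<open>f (x \<otimes> g) * L (delta x) \<one>\<close>.\<close>
  have "L f = (\<Sum>x\<in>carrier G. fscale (L (delta x) \<one>) (ltr x f))"
  proof
    fix g
    show "L f g = (\<Sum>x\<in>carrier G. fscale (L (delta x) \<one>) (ltr x f)) g"
    proof (cases "g \<in> carrier G")
      case True
      then have t: "rtr g \<in> translation_maps" by (simp add: translation_maps_def)
      have "L f g = rtr g (L f) \<one>" using True by (simp add: rtr_def)
      also have "\<dots> = L (rtr g f) \<one>" using comm t fG by simp
      also have "\<dots> = (\<Sum>x\<in>carrier G. rtr g f x * L (delta x) \<one>)"
        using arg_cong[OF linear_endo_expand[OF fin L translation_in[OF t]], of "\<lambda>F. F \<one>"]
        by (simp add: sum_fun_apply fscale_def)
      also have "\<dots> = (\<Sum>x\<in>carrier G. fscale (L (delta x) \<one>) (ltr x f)) g"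
        using True by (simp add: sum_fun_apply fscale_def rtr_def ltr_def mult.commute)
      finally show ?thesis .
    next
      case False
      then show ?thesis
        using L fG by (simp add: linear_endo_def functions_on_def sum_fun_apply fscale_def ltr_def)
    qed
  qed
  moreover have "ltr x f \<in> M" if "x \<in> carrier G" for x
    using M(1) f that by (auto simp: invariant_subspace_def translation_maps_def)
  ultimately show ?thesis
    using M(1) by (auto simp: invariant_subspace_def intro!: fn.subspace_sum fn.subspace_scale)
qed

lemma eigenspace_invariant:
  assumes L: "linear_endo (group_functions G) L"
    and comm: "\<forall>t\<in>translation_maps. \<forall>f\<in>group_functions G. L (t f) = t (L f)"
  shows "invariant_subspace translation_maps (eigenspace (group_functions G) L c)"
  unfolding invariant_subspace_def
proof (intro conjI ballI subsetI)
  show "fn.subspace (eigenspace (group_functions G) L c)"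
    by (rule eigenspace_subspace[OF subspace_functions_on L])
next
  fix t f
  assume "t \<in> translation_maps" "f \<in> t ` eigenspace (group_functions G) L c"
  then show "f \<in> eigenspace (group_functions G) L c"
    using comm by (auto simp: eigenspace_def translation_in translation_scale)
qed

text \<open>Schur's lemma for biinvariant spaces: \<open>L\<close> has an eigenvector in
  \<open>M\<close>, and the part of its eigenspace in \<open>M\<close> is invariant and nonzero,
  hence all of \<open>M\<close>.\<close>

lemma commuting_map_scalar:
  assumes L: "linear_endo (group_functions G) L"
    and comm: "\<forall>t\<in>translation_maps. \<forall>f\<in>group_functions G. L (t f) = t (L f)"
    and M: "minimal_invariant translation_maps M" "M \<subseteq> group_functions G"
  shows "\<exists>c. \<forall>f\<in>M. L f = fscale c f"
proof -
  have inv: "invariant_subspace translation_maps M" and ne: "M \<noteq> {0}" and sub: "fn.subspace M"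
    using M(1) by (auto simp: minimal_invariant_def invariant_subspace_def)
  obtain n e where "orthonormal_basis (carrier G) M n e"
    using orthonormal_basis_exists[OF fin sub M(2)] by blast
  then interpret orthonormal_basis "carrier G" M n e .
  have "L ` M \<subseteq> M"
    using commuting_map_preserves_invariant[OF L comm inv M(2)] by blast
  then obtain c f where f: "f \<in> M" "f \<noteq> 0" "L f = fscale c f"
    using eigenvector_exists[OF subspace_functions_on M(2) L _ ne] by blast
  let ?E = "M \<inter> eigenspace (group_functions G) L c"
  have "invariant_subspace translation_maps ?E"
    using inv eigenspace_invariant[OF L comm, of c]
    unfolding invariant_subspace_def by (blast intro: fn.subspace_inter)
  moreover have "f \<in> ?E" using f M(2) by (auto simp: eigenspace_def)
  ultimately have "?E = M" using M(1) f(2) unfolding minimal_invariant_def by blast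
  then show ?thesis by (auto simp: eigenspace_def)
qed

section \<open>The irreducible representation on a minimal right-invariant space\<close>

lemma rtr_rtr: "a \<in> carrier G \<Longrightarrow> b \<in> carrier G \<Longrightarrow> rtr a (rtr b f) = rtr (a \<otimes> b) f"
  by (auto simp: rtr_def fun_eq_iff m_assoc)

lemma rtr_one: "f \<in> group_functions G \<Longrightarrow> rtr \<one> f = f"
  by (auto simp: rtr_def fun_eq_iff functions_on_def)

context
  fixes V n e
  assumes V: "minimal_invariant (rtr ` carrier G) V" "V \<subseteq> group_functions G"
    and e: "orthonormal_basis (carrier G) V n e"
begin

interpretation e: orthonormal_basis "carrier G" V n e by (rule e)

lemma rtr_in: "a \<in> carrier G \<Longrightarrow> rtr a ` V \<subseteq> V"
  using V(1) by (auto simp: minimal_invariant_def invariant_subspace_def)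

lemma rtr_linear: "a \<in> carrier G \<Longrightarrow> linear_endo (group_functions G) (rtr a)"
  by (rule translation_linear_endo) (simp add: translation_maps_def)

text \<open>Composition of right translations becomes matrix multiplication; the matrix for
  \<open>inv g\<close> supplies the inverse that membership in the unit group asks for.\<close>

lemma rtr_matrix_rep: "matrix_rep G n (\<lambda>g. e.matrix_of (rtr g))"
proof -
  have mult: "e.matrix_of (rtr (a \<otimes> b)) = e.matrix_of (rtr a) * e.matrix_of (rtr b)"
    if "a \<in> carrier G" "b \<in> carrier G" for a b
    using e.matrix_of_compose[OF subspace_functions_on V(2) rtr_linear rtr_in rtr_in, of a b] that
    by (simp add: rtr_rtr)
  have one: "e.matrix_of (rtr \<one>) = 1\<^sub>m n"
    using V(2) e.basis_in
    by (intro eq_matI) (auto simp: e.matrix_of_def rtr_one subset_iff e.orthonormal)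
  have "e.matrix_of (rtr g) \<in> Units (ring_mat TYPE(complex) n ())" if "g \<in> carrier G" for g
    using mult[of g "inv g"] mult[of "inv g" g] that one
    by (auto simp: Units_def ring_mat_simps intro!: bexI[of _ "e.matrix_of (rtr (inv g))"])
  then show ?thesis
    using mult by (auto simp: matrix_rep_def hom_def units_of_def ring_mat_simps)
qed

text \<open>\<open>comb\<close> intertwines the matrices with right translation, so it carries an
  invariant \<open>W\<close> to a right-invariant subspace of \<open>V\<close>. Minimality of
  \<open>V\<close> leaves two images, and injectivity of \<open>comb\<close> pulls them back to
  \<open>W\<close>.\<close>

lemma rtr_irreducible_rep: "irreducible_rep G n (\<lambda>g. e.matrix_of (rtr g))"
  unfolding irreducible_rep_def
proof (intro conjI allI impI rtr_matrix_rep)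
  have ne: "V \<noteq> {0}" using V(1) by (simp add: minimal_invariant_def)
  then obtain f where "f \<in> V" "f \<noteq> 0" using fn.subspace_0[OF e.subspace] by blast
  then show "n > 0" using e.expand[of f] by (cases n) auto
next
  fix W
  assume W: "VectorSpace.subspace class_ring W (module_vec TYPE(complex) n) \<and>
    (\<forall>g\<in>carrier G. \<forall>v\<in>W. e.matrix_of (rtr g) *\<^sub>v v \<in> W)"
  then have "submodule class_ring W (module_vec TYPE(complex) n)"
    by (simp add: VectorSpace.subspace_def)
  then have Wc: "W \<subseteq> carrier_vec n" and W0: "0\<^sub>v n \<in> W"
    and Wadd: "\<And>v w. v \<in> W \<Longrightarrow> w \<in> W \<Longrightarrow> v + w \<in> W"
    and Wsm: "\<And>c v. v \<in> W \<Longrightarrow> c \<cdot>\<^sub>v v \<in> W"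
    by (auto simp: submodule_def module_vec_simps)
  have sub: "fn.subspace (e.comb ` W)"
  proof (rule fn.subspaceI)
    show "0 \<in> e.comb ` W" using W0 e.comb_zero by (metis imageI)
    show "f + h \<in> e.comb ` W" if "f \<in> e.comb ` W" "h \<in> e.comb ` W" for f h
      using that Wc Wadd e.comb_add by (smt (verit) image_iff subsetD)
    show "fscale c f \<in> e.comb ` W" if "f \<in> e.comb ` W" for c f
      using that Wc Wsm e.comb_smult by (smt (verit) image_iff subsetD)
  qed
  have "rtr g (e.comb w) \<in> e.comb ` W" if "g \<in> carrier G" "w \<in> W" for g w
    using e.apply_comb[OF subspace_functions_on V(2) rtr_linear rtr_in, of g w] that W Wc by auto
  then have "invariant_subspace (rtr ` carrier G) (e.comb ` W)"
    using sub by (auto simp: invariant_subspace_def)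
  moreover have "e.comb ` W \<subseteq> V" using e.comb_in by blast
  ultimately consider "e.comb ` W = {0}" | "e.comb ` W = V"
    using V(1) unfolding minimal_invariant_def by blast
  then show "W = {0\<^sub>v n} \<or> W = carrier_vec n"
  proof cases
    case 1
    then have "w = 0\<^sub>v n" if "w \<in> W" for w
      using that Wc e.comb_inj[of w "0\<^sub>v n"] e.comb_zero by auto
    then show ?thesis using W0 by blast
  next
    case 2
    then have "w \<in> W" if "w \<in> carrier_vec n" for w
      using that Wc e.comb_inj[of w] e.comb_in[of w] by (metis imageE subsetD)
    then show ?thesis using Wc by blast
  qed
qed

lemma subset_rtr_coeff_space: "V \<subseteq> coeff_space G n (\<lambda>g. e.matrix_of (rtr g))"
proof
  let ?\<rho> = "\<lambda>g. e.matrix_of (rtr g)"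
  fix f
  assume f: "f \<in> V"
  have e_in: "e j \<in> coeff_space G n ?\<rho>" if j: "j < n" for j
  proof -
    \<comment> \<open>The coefficients come from evaluating at the identity: \<open>e j g\<close> is
      the value of \<open>rtr g (e j)\<close> at \<open>\<one>\<close>, and the coordinates of
      \<open>rtr g (e j)\<close> are the entries of column \<open>j\<close>.\<close>
    have "e j = (\<Sum>i<n. fscale (e i \<one>) (matrix_coeff G ?\<rho> i j))"
    proof
      fix g
      show "e j g = (\<Sum>i<n. fscale (e i \<one>) (matrix_coeff G ?\<rho> i j)) g"
      proof (cases "g \<in> carrier G")
        case True
        then have "rtr g (e j) = (\<Sum>i<n. fscale (ip (carrier G) (rtr g (e j)) (e i)) (e i))"
          using e.expand[of "rtr g (e j)"] rtr_in[OF True] e.basis_in[OF j] by blast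
        from arg_cong[OF this, of "\<lambda>F. F \<one>"] show ?thesis
          using True j
          by (simp add: rtr_def[of g "e j"] sum_fun_apply fscale_def matrix_coeff_def e.matrix_of_def
              mult.commute)
      next
        case False
        then show ?thesis
          using e.basis_in[OF j] V(2)
          by (auto simp: functions_on_def sum_fun_apply fscale_def matrix_coeff_def)
      qed
    qed
    also have "\<dots> \<in> coeff_space G n ?\<rho>"
      unfolding coeff_space_def using j
      by (intro fn.span_sum fn.span_scale fn.span_base) auto
    finally show ?thesis .
  qed
  have "(\<Sum>i<n. fscale (ip (carrier G) f (e i)) (e i)) \<in> coeff_space G n ?\<rho>"
    using e_in unfolding coeff_space_def by (intro fn.span_sum fn.span_scale) auto
  then show "f \<in> coeff_space G n ?\<rho>" using e.expand[OF f] by simp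
qed

lemma rtr_coeff_space_subset:
  assumes M: "invariant_subspace translation_maps M" "V \<subseteq> M"
  shows "coeff_space G n (\<lambda>g. e.matrix_of (rtr g)) \<subseteq> M"
  unfolding coeff_space_def
proof (rule fn.span_minimal)
  let ?\<rho> = "\<lambda>g. e.matrix_of (rtr g)"
  show sub: "fn.subspace M" using M(1) by (simp add: invariant_subspace_def)
  have "matrix_coeff G ?\<rho> i j \<in> M" if "i < n" "j < n" for i j
  proof -
    \<comment> \<open>The pairing of \<open>rtr g (e j)\<close> with \<open>e i\<close> sums
      \<open>e j (x \<otimes> g) * cnj (e i x)\<close> over \<open>x\<close>; read as a function of
      \<open>g\<close>, the first factor is a left translate of \<open>e j\<close>. Here invariance
      of \<open>M\<close> under left translations enters.\<close>
    have "matrix_coeff G ?\<rho> i j = (\<Sum>x\<in>carrier G. fscale (cnj (e i x)) (ltr x (e j)))"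
      using that
      by (auto simp: fun_eq_iff matrix_coeff_def e.matrix_of_def ip_def sum_fun_apply fscale_def
          ltr_def rtr_def mult.commute)
    moreover have "ltr x (e j) \<in> M" if "x \<in> carrier G" for x
      using M e.basis_in[OF \<open>j < n\<close>] that
      by (auto simp: invariant_subspace_def translation_maps_def)
    ultimately show ?thesis
      by (auto intro!: fn.subspace_sum[OF sub] fn.subspace_scale[OF sub])
  qed
  then show "{matrix_coeff G ?\<rho> i j | i j. i < n \<and> j < n} \<subseteq> M" by blast
qed

end

text \<open>Forgetting left translations, \<open>M\<close> contains a minimal right-invariant
  \<open>V\<close>. The coefficient space of its representation contains \<open>V\<close>, so it is
  nonzero; it is biinvariant and lies in \<open>M\<close>, so minimality gives equality.\<close>

lemma minimal_invariant_eq_coeff_space: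
  assumes M: "minimal_invariant translation_maps M" "M \<subseteq> group_functions G"
  shows "\<exists>n \<rho>. irreducible_rep G n \<rho> \<and> M = coeff_space G n \<rho>"
proof -
  have inv: "invariant_subspace translation_maps M" and ne: "M \<noteq> {0}"
    using M(1) by (auto simp: minimal_invariant_def)
  then have "invariant_subspace (rtr ` carrier G) M"
    by (auto simp: invariant_subspace_def translation_maps_def)
  then obtain V where V: "V \<subseteq> M" "minimal_invariant (rtr ` carrier G) V"
    using minimal_invariant_exists[OF fin _ ne M(2)] by blast
  have VG: "V \<subseteq> group_functions G" using V(1) M(2) by blast
  have subV: "fn.subspace V" and neV: "V \<noteq> {0}"
    using V(2) by (auto simp: minimal_invariant_def invariant_subspace_def)
  obtain n e where e: "orthonormal_basis (carrier G) V n e"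
    using orthonormal_basis_exists[OF fin subV VG] by blast
  define \<rho> where "\<rho> = (\<lambda>g. orthonormal_basis.matrix_of (carrier G) n e (rtr g))"
  have irr: "irreducible_rep G n \<rho>"
    unfolding \<rho>_def by (rule rtr_irreducible_rep[OF V(2) VG e])
  have "V \<subseteq> coeff_space G n \<rho>"
    unfolding \<rho>_def by (rule subset_rtr_coeff_space[OF V(2) VG e])
  then have "coeff_space G n \<rho> \<noteq> {0}"
    using neV fn.subspace_0[OF subV] by blast
  moreover have "coeff_space G n \<rho> \<subseteq> M"
    unfolding \<rho>_def by (rule rtr_coeff_space_subset[OF V(2) VG e inv V(1)])
  moreover have "invariant_subspace translation_maps (coeff_space G n \<rho>)"
    using irr coeff_space_invariant by (simp add: irreducible_rep_def)
  ultimately have "M = coeff_space G n \<rho>"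
    using M(1) unfolding minimal_invariant_def by blast
  then show ?thesis using irr by blast
qed

section \<open>Decomposition of eigenspaces and the equivalence\<close>

lemma invariant_subspace_decomposition:
  assumes "invariant_subspace translation_maps U" "U \<subseteq> group_functions G"
  obtains \<W> where "\<forall>W\<in>\<W>. minimal_invariant translation_maps W" "internal_direct_sum U \<W> (\<lambda>W. W)"
proof -
  have "\<exists>\<W>. (\<forall>W\<in>\<W>. minimal_invariant translation_maps W) \<and> internal_direct_sum U \<W> (\<lambda>W. W)"
    by (rule complete_reducibility[OF fin translation_adjoint assms])
  then show ?thesis using that by blast
qed

text \<open>Forwards, \<open>L\<close> is scalar on the minimal summands of the whole space, so it
  is diagonalisable, and each eigenspace is biinvariant and decomposes in turn. Backwards,
  translations preserve every eigenspace, on which \<open>L\<close> is a scalar, so the two commute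
  there and hence on the sum.\<close>

lemma commuting_map_iff_eigenspaces:
  assumes L: "linear_endo (group_functions G) L"
  shows "(\<forall>t\<in>translation_maps. \<forall>f\<in>group_functions G. L (t f) = t (L f)) \<longleftrightarrow>
    internal_direct_sum (group_functions G)
      (eigenvalues (group_functions G) L) (eigenspace (group_functions G) L) \<and>
    (\<forall>c \<in> eigenvalues (group_functions G) L.
       \<exists>\<W>. (\<forall>W\<in>\<W>. \<exists>n \<rho>. irreducible_rep G n \<rho> \<and> W = coeff_space G n \<rho>) \<and>
           internal_direct_sum (eigenspace (group_functions G) L c) \<W> (\<lambda>W. W))"
    (is "?comm \<longleftrightarrow> ?ds \<and> ?coeff")
proof (intro iffI conjI ballI)
  assume comm: ?comm
  have "invariant_subspace translation_maps (group_functions G)"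
    by (auto simp: invariant_subspace_def subspace_functions_on translation_in)
  then obtain \<W> where W: "\<forall>W\<in>\<W>. minimal_invariant translation_maps W"
    "internal_direct_sum (group_functions G) \<W> (\<lambda>W. W)"
    using invariant_subspace_decomposition by blast
  show ?ds
    using eigenspaces_direct_sum[OF subspace_functions_on L W(2)] commuting_map_scalar[OF L comm]
      W(1) internal_direct_sum_component[OF W(2)] by blast
next
  fix c
  assume comm: ?comm
  have E: "eigenspace (group_functions G) L c \<subseteq> group_functions G" by (auto simp: eigenspace_def)
  obtain \<W> where W: "\<forall>W\<in>\<W>. minimal_invariant translation_maps W"
    "internal_direct_sum (eigenspace (group_functions G) L c) \<W> (\<lambda>W. W)"
    using invariant_subspace_decomposition[OF eigenspace_invariant[OF L comm] E] by blast
  have "\<exists>n \<rho>. irreducible_rep G n \<rho> \<and> W = coeff_space G n \<rho>" if "W \<in> \<W>" for W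
    using minimal_invariant_eq_coeff_space[of W] W(1) that
      internal_direct_sum_component[OF W(2) that] E by blast
  then show "\<exists>\<W>. (\<forall>W\<in>\<W>. \<exists>n \<rho>. irreducible_rep G n \<rho> \<and> W = coeff_space G n \<rho>) \<and>
      internal_direct_sum (eigenspace (group_functions G) L c) \<W> (\<lambda>W. W)"
    using W(2) by blast
next
  fix t f
  assume rhs: "?ds \<and> ?coeff" and t: "t \<in> translation_maps" and f: "f \<in> group_functions G"
  let ?V = "group_functions G"
  note t_sum = linear_endo_sum[OF subspace_functions_on translation_linear_endo[OF t]]
  \<comment> \<open>Each component of \<open>h\<close> stays in its own coefficient space under
    \<open>t\<close>, so the translated components again sum to an element of the
    eigenspace.\<close>
  have inv: "t h \<in> eigenspace ?V L c" if c: "c \<in> eigenvalues ?V L" and h: "h \<in> eigenspace ?V L c" for c h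
  proof -
    obtain \<W> where W: "\<forall>W\<in>\<W>. \<exists>n \<rho>. irreducible_rep G n \<rho> \<and> W = coeff_space G n \<rho>"
      "internal_direct_sum (eigenspace ?V L c) \<W> (\<lambda>W. W)"
      using rhs c by blast
    then obtain w where w: "h = (\<Sum>W\<in>\<W>. w W)" "\<forall>W\<in>\<W>. w W \<in> W"
      using h unfolding internal_direct_sum_def by blast
    have step: "t (w W) \<in> W" "w W \<in> ?V" if "W \<in> \<W>" for W
    proof -
      obtain n \<rho> where n: "irreducible_rep G n \<rho>" "W = coeff_space G n \<rho>"
        using W(1) \<open>W \<in> \<W>\<close> by blast
      have "invariant_subspace translation_maps W" "W \<subseteq> ?V"
        unfolding n(2) using n(1) coeff_space_invariant[of n \<rho>] coeff_space_subset[of G n \<rho>]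
        by (simp_all add: irreducible_rep_def)
      then show "t (w W) \<in> W" "w W \<in> ?V"
        using w(2) that t unfolding invariant_subspace_def by blast+
    qed
    have th: "t h = (\<Sum>W\<in>\<W>. t (w W))"
      unfolding w(1) by (rule t_sum) (rule step(2))
    have eig: "eigenspace ?V L c = {\<Sum>W\<in>\<W>. w W | w. \<forall>W\<in>\<W>. w W \<in> W}"
      using W(2) unfolding internal_direct_sum_def by (elim conjE)
    show ?thesis
      unfolding eig using th step(1) by (intro CollectI exI[of _ "\<lambda>W. t (w W)"] conjI ballI)
  qed
  obtain w where w: "f = (\<Sum>c\<in>eigenvalues ?V L. w c)" "\<forall>c\<in>eigenvalues ?V L. w c \<in> eigenspace ?V L c"
    using f conjunct1[OF rhs] unfolding internal_direct_sum_def by blast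
  have wV: "w c \<in> ?V" "L (w c) = fscale c (w c)" "t (w c) \<in> ?V" "L (t (w c)) = fscale c (t (w c))"
    if "c \<in> eigenvalues ?V L" for c
    using w(2) inv[OF that] that by (auto simp: eigenspace_def)
  have "L (t f) = L (\<Sum>c\<in>eigenvalues ?V L. t (w c))"
    unfolding w(1) using wV(1) by (subst t_sum) auto
  also have "\<dots> = (\<Sum>c\<in>eigenvalues ?V L. L (t (w c)))"
    by (rule linear_endo_sum[OF subspace_functions_on L]) (rule wV(3))
  also have "\<dots> = (\<Sum>c\<in>eigenvalues ?V L. t (L (w c)))"
    by (rule sum.cong) (simp_all add: wV(2,4) translation_scale[OF t])
  also have "\<dots> = t (\<Sum>c\<in>eigenvalues ?V L. L (w c))"
    using wV(1) L by (intro t_sum[symmetric]) (simp add: linear_endo_def)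
  also have "(\<Sum>c\<in>eigenvalues ?V L. L (w c)) = L f"
    unfolding w(1) by (rule linear_endo_sum[OF subspace_functions_on L, symmetric]) (rule wV(1))
  finally show "L (t f) = t (L f)" .
qed

end

theorem lemma4p18:
  fixes G :: "('g, 'm) monoid_scheme"
    and L :: "('g \<Rightarrow> complex) \<Rightarrow> 'g \<Rightarrow> complex"
  assumes "group G"
    and "finite (carrier G)"
    and "linear_endo (group_functions G) L"
  shows "bicomodule_map G (left_coregular G) (right_coregular G) L \<longleftrightarrow>
    internal_direct_sum (group_functions G)
      (eigenvalues (group_functions G) L) (eigenspace (group_functions G) L) \<and>
    (\<forall>c \<in> eigenvalues (group_functions G) L.
       \<exists>\<W>. (\<forall>W\<in>\<W>. \<exists>n \<rho>. irreducible_rep G n \<rho> \<and> W = coeff_space G n \<rho>) \<and>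
           internal_direct_sum (eigenspace (group_functions G) L c) \<W> (\<lambda>W. W))"
proof -
  interpret group G by fact
  interpret finite_group_functions G by unfold_locales fact
  show ?thesis
    unfolding bicomodule_map_iff[OF assms(3)] by (rule commuting_map_iff_eigenspaces[OF assms(3)])
qed

end
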